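(* Let $\Gamma$ be a finite, connected, simple, undirected graph with at least one edge, $n$ vertices and $m$ edges, $G$ a group, and $s_1,s_2\in Z(G)$ with $s_1^2=s_2^2=1_G$. Let $q$ be the number of edges of $L(\Gamma)$. For every $H\in\mathcal H_\Gamma$, $g\in G^m$ and $f\in G^n$: (1) $L(H\underline g)=\underline g^{\,*}L(H)$; (2) $L(\underline f^{\,*}H)=L(H)\underline{f'}$ for some $f'\in G^q$; (3) $\Psi_L(H)=s_1s_2\,\Psi(L(H))$, i.e. $\Psi_L(H)(e_i,e_j)=s_1s_2\,\Psi(L(H))(e_i,e_j)$ for all adjacent $e_i,e_j$ in $L(\Gamma)$.
   Context: Fix orders $V_\Gamma=\{v_1,\dots,v_n\}$, $E_\Gamma=\{e_1,\dots,e_m\}$; write $v_i\in e_j$ if $v_i$ is an endpoint of $e_j$, and $e_i\cap e_j$ for the common endpoint of distinct edges sharing a vertex. The line graph $L(\Gamma)$ has vertex set $E_\Gamma$ (ordered $e_1,\dots,e_m$), with $e_i\sim e_j$ iff they share an endpoint; fix an order $E_1,\dots,E_q$ of its edges and for $E_k=\{e_i,e_j\}$ put $v(E_k)=e_i\cap e_j$. $\mathbb CG$ is the complex group algebra with involution $(\sum f_xx)^*=\sum\overline{f_x}x^{-1}$, $(A^* )_{i,j}=(A_{j,i})^*$. For any graph $\Lambda$ with ordered vertices $w_1,\dots,w_p$ and edges $\epsilon_1,\dots,\epsilon_r$, a $G$-phase of $\Lambda$ is $H\in M_{p\times r}(\mathbb CG)$ with $H_{i,j}\in G$ if $w_i\in\epsilon_j$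 and $0$ otherwise; $\mathcal H_\Lambda$ is their set, and $\Psi(H)$ is the gain function on $\Lambda$ (map on ordered pairs of adjacent vertices into $G$, inverting under reversal) with $\Psi(H)(w_i,w_j)=s_1H_{i,k}H_{j,k}^{-1}$ for $\epsilon_k=\{w_i,w_j\}$. For $H\in\mathcal H_\Gamma$, $\Psi_L(H)$ is the gain function on $L(\Gamma)$ with $\Psi_L(H)(e_i,e_j)=s_2H_{k,i}^{-1}H_{k,j}$ for $v_k=e_i\cap e_j$. The map $L\colon\mathcal H_\Gamma\to\mathcal H_{L(\Gamma)}$ is $L(H)_{i,k}=0$ if $e_i\notin E_k$ and $L(H)_{i,k}=H_{l,i}^{-1}$ if $e_i\in E_k$ and $v(E_k)=v_l$. For $g\in G^k$, $\underline g=\mathrm{diag}(g_1,\dots,g_k)$. *)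

theory Defs
  imports
    Complex_Main
    "HOL-Library.Poly_Mapping"
    "Jordan_Normal_Form.Matrix"
begin

section \<open>Simple graphs and line graphs\<close>

type_synonym 'v ugraph = "'v set \<times> 'v set set"

abbreviation verts :: "'v ugraph \<Rightarrow> 'v set" where
  "verts \<Gamma> \<equiv> fst \<Gamma>"

abbreviation edges :: "'v ugraph \<Rightarrow> 'v set set" where
  "edges \<Gamma> \<equiv> snd \<Gamma>"

definition simple_graph :: "'v ugraph \<Rightarrow> bool" where
  "simple_graph \<Gamma> \<longleftrightarrow> (\<forall>e\<in>edges \<Gamma>. e \<subseteq> verts \<Gamma> \<and> card e = 2)"

definition adjacent :: "'v ugraph \<Rightarrow> 'v \<Rightarrow> 'v \<Rightarrow> bool" where
  "adjacent \<Gamma> u v \<longleftrightarrow> {u, v} \<in> edges \<Gamma>"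

definition connected_graph :: "'v ugraph \<Rightarrow> bool" where
  "connected_graph \<Gamma> \<longleftrightarrow> verts \<Gamma> \<noteq> {} \<and>
     (\<forall>u\<in>verts \<Gamma>. \<forall>v\<in>verts \<Gamma>. (adjacent \<Gamma>)\<^sup>*\<^sup>* u v)"

definition line_graph :: "'v ugraph \<Rightarrow> 'v set ugraph" where
  "line_graph \<Gamma> =
     (edges \<Gamma>, {{e, e'} | e e'. e \<in> edges \<Gamma> \<and> e' \<in> edges \<Gamma> \<and> e \<noteq> e' \<and> e \<inter> e' \<noteq> {}})"

text \<open>A list without repetitions fixes an order on a finite set. List positions, like the
  matrix indices, start at \<open>0\<close>.\<close>

definition enumerates :: "'a list \<Rightarrow> 'a set \<Rightarrow> bool" where
  "enumerates xs A \<longleftrightarrow> distinct xs \<and> set xs = A"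

definition pos :: "'a list \<Rightarrow> 'a \<Rightarrow> nat" where
  "pos xs x = (THE i. i < length xs \<and> xs ! i = x)"

text \<open>The common endpoint of two distinct edges \<open>e\<close>, \<open>e'\<close>, as a function of the edge
  \<open>{e, e'}\<close> of the line graph.\<close>

definition common_vertex :: "'v set set \<Rightarrow> 'v" where
  "common_vertex P = the_elem (\<Inter> P)"

section \<open>The complex group algebra\<close>

text \<open>The group \<open>G\<close> is the carrier of a type of class \<^class>\<open>group_add\<close>: an arbitrary, not
  necessarily commutative group whose operation is written additively. This is the convention
  under which the convolution product in \<^theory>\<open>HOL-Library.Poly_Mapping\<close> makes the finitely
  supported functions \<open>G \<Rightarrow> complex\<close> into the group algebra. So \<open>x + y\<close>, \<open>- x\<close>, \<open>x - y\<close> and \<open>0\<close>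
  in \<open>'g\<close> are the multiplicative \<open>xy\<close>, \<open>x\<close>-inverse, \<open>x\<close> times \<open>y\<close>-inverse and the unit of \<open>G\<close>.\<close>

type_synonym 'g group_algebra = "'g \<Rightarrow>\<^sub>0 complex"

definition group_center :: "'g::group_add set" where
  "group_center = {z. \<forall>x. z + x = x + z}"

definition elt :: "'g \<Rightarrow> 'g group_algebra" where
  "elt x = Poly_Mapping.single x 1"

definition the_elt :: "'g group_algebra \<Rightarrow> 'g" where
  "the_elt a = (THE x. a = elt x)"

definition star :: "'g::group_add group_algebra \<Rightarrow> 'g group_algebra" where
  "star a = (\<Sum>x\<in>Poly_Mapping.keys a.
     Poly_Mapping.single (- x) (cnj (Poly_Mapping.lookup a x)))"

definition mat_star :: "'g::group_add group_algebra mat \<Rightarrow> 'g group_algebra mat" where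
  "mat_star A = mat (dim_col A) (dim_row A) (\<lambda>(i, j). star (A $$ (j, i)))"

definition group_diag :: "'g vec \<Rightarrow> 'g group_algebra mat" where
  "group_diag g = mat_diag (dim_vec g) (\<lambda>i. elt (g $ i))"

section \<open>Phases and gain functions\<close>

definition phases :: "'w list \<Rightarrow> 'w set list \<Rightarrow> 'g group_algebra mat set" where
  "phases ws es = {H \<in> carrier_mat (length ws) (length es).
     \<forall>i<length ws. \<forall>j<length es.
       if ws ! i \<in> es ! j then H $$ (i, j) \<in> range elt else H $$ (i, j) = 0}"

definition gain_function :: "'w ugraph \<Rightarrow> ('w \<Rightarrow> 'w \<Rightarrow> 'g::group_add) \<Rightarrow> bool" where
  "gain_function \<Lambda> \<psi> \<longleftrightarrow> (\<forall>u v. adjacent \<Lambda> u v \<longrightarrow> \<psi> v u = - \<psi> u v)"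

text \<open>The gain functions below are total functions; only their values on ordered pairs of
  adjacent vertices are meaningful.\<close>

definition Psi ::
  "'g::group_add \<Rightarrow> 'w list \<Rightarrow> 'w set list \<Rightarrow> 'g group_algebra mat \<Rightarrow> 'w \<Rightarrow> 'w \<Rightarrow> 'g" where
  "Psi s ws es H u v =
     (let k = pos es {u, v}
      in s + the_elt (H $$ (pos ws u, k)) - the_elt (H $$ (pos ws v, k)))"

definition Psi_L ::
  "'g::group_add \<Rightarrow> 'v list \<Rightarrow> 'v set list \<Rightarrow> 'g group_algebra mat \<Rightarrow> 'v set \<Rightarrow> 'v set \<Rightarrow> 'g" where
  "Psi_L s vs es H e e' =
     (let k = pos vs (common_vertex {e, e'})
      in s + - the_elt (H $$ (k, pos es e)) + the_elt (H $$ (k, pos es e')))"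

definition line_phase ::
  "'v list \<Rightarrow> 'v set list \<Rightarrow> 'v set set list \<Rightarrow> 'g::group_add group_algebra mat
    \<Rightarrow> 'g group_algebra mat" where
  "line_phase vs es Es H = mat (length es) (length Es) (\<lambda>(i, k).
     if es ! i \<in> Es ! k
     then elt (- the_elt (H $$ (pos vs (common_vertex (Es ! k)), i)))
     else 0)"

lemma elt_inject [simp]: "elt x = elt y \<longleftrightarrow> x = y"
  unfolding elt_def by (metis one_neq_zero lookup_single_eq lookup_single_not_eq)

lemma the_elt_elt [simp]: "the_elt (elt x) = x"
  unfolding the_elt_def by simp

lemma star_elt [simp]: "star (elt x) = elt (- x)"
  unfolding star_def elt_def by simp

lemma line_phase_in_phases: "line_phase vs es Es H \<in> phases es Es"
  unfolding phases_def line_phase_def by auto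

lemma gain_function_Psi:
  assumes "s \<in> group_center" "s + s = 0"
  shows "gain_function \<Lambda> (Psi s ws es H)"
proof -
  have c: "x + s = s + x" for x
    using assms(1) by (simp add: group_center_def)
  have m: "- s = s"
    using assms(2) by (simp add: minus_unique)
  show ?thesis
    by (simp add: gain_function_def Psi_def Let_def insert_commute minus_add m c
        diff_conv_add_uminus add.assoc del: add_uminus_conv_diff)
qed

lemma gain_function_Psi_L:
  assumes "s \<in> group_center" "s + s = 0"
  shows "gain_function \<Lambda> (Psi_L s vs es H)"
proof -
  have c: "x + s = s + x" for x
    using assms(1) by (simp add: group_center_def)
  have m: "- s = s"
    using assms(2) by (simp add: minus_unique)
  show ?thesis
    by (simp add: gain_function_def Psi_L_def Let_def insert_commute minus_add m c
        diff_conv_add_uminus add.assoc[symmetric] del: add_uminus_conv_diff)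
qed

end

theory Submission
  imports Defs
begin

text \<open>Because the graph is simple, an edge \<open>E\<close> of the line graph has a single common vertex,
  which lies in both members of \<open>E\<close>. So every nonzero entry of a column of \<open>L(H)\<close> is the inverse
  of an entry of one row of \<open>H\<close>: scaling the columns of \<open>H\<close> scales the rows of \<open>L(H)\<close>, and scaling
  the rows of \<open>H\<close> scales the column of \<open>E\<close> by the scalar attached to its common vertex.\<close>

lemma elt_mult: "elt x * elt y = elt (x + y)"
  by (simp add: elt_def mult_single)

lemma star_zero [simp]: "star 0 = 0"
  by (simp add: star_def)

text \<open>\<open>pos\<close> is a definite description, so it can be used only where the index is
  unique; \<open>distinct\<close> supplies this uniqueness.\<close>

lemma pos_less_length: "distinct xs \<Longrightarrow> x \<in> set xs \<Longrightarrow> pos xs x < length xs"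
  and nth_pos: "distinct xs \<Longrightarrow> x \<in> set xs \<Longrightarrow> xs ! pos xs x = x"
proof -
  assume "distinct xs" "x \<in> set xs"
  then have "\<exists>!i. i < length xs \<and> xs ! i = x"
    by (metis in_set_conv_nth nth_eq_iff_index_eq)
  from theI'[OF this] show "pos xs x < length xs" "xs ! pos xs x = x"
    by (simp_all add: pos_def)
qed

lemma enumerates_length: "enumerates xs A \<Longrightarrow> length xs = card A"
  by (metis enumerates_def distinct_card)

lemma mult_group_diag:
  fixes A :: "'g::group_add group_algebra mat"
  assumes "A \<in> carrier_mat n m" "g \<in> carrier_vec m"
  shows "A * group_diag g = mat n m (\<lambda>(i, j). A $$ (i, j) * elt (g $ j))"
  using assms by (simp add: group_diag_def mat_diag_mult_right)

lemma mat_star_group_diag: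
  "mat_star (group_diag g) = mat_diag (dim_vec g) (\<lambda>i. elt (- (g $ i)))"
  by (rule eq_matI) (auto simp: mat_star_def group_diag_def mat_diag_def)

lemma mat_star_group_diag_mult:
  fixes A :: "'g::group_add group_algebra mat"
  assumes "A \<in> carrier_mat n m" "f \<in> carrier_vec n"
  shows "mat_star (group_diag f) * A = mat n m (\<lambda>(i, j). elt (- (f $ i)) * A $$ (i, j))"
  using assms by (simp add: mat_star_group_diag mat_diag_mult_left)

lemma phases_entry:
  assumes "H \<in> phases ws es" "i < length ws" "j < length es" "ws ! i \<in> es ! j"
  shows "H $$ (i, j) = elt (the_elt (H $$ (i, j)))"
proof -
  have "H $$ (i, j) \<in> range elt"
    using assms by (auto simp: phases_def)
  then show ?thesis by auto
qed

text \<open>Two sets of size 2 that share two points coincide, so distinct edges meet in at most one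
  vertex.\<close>

lemma simple_graph_inter_edges:
  assumes "simple_graph \<Gamma>" "e \<in> edges \<Gamma>" "e' \<in> edges \<Gamma>" "e \<noteq> e'" "e \<inter> e' \<noteq> {}"
  shows "\<exists>v. e \<inter> e' = {v}"
proof -
  from assms have "card e = 2" "card e' = 2"
    by (auto simp: simple_graph_def)
  then obtain a b c d where "e = {a, b}" "e' = {c, d}" by (meson card_2_iff)
  with assms(4,5) show ?thesis by auto
qed

text \<open>\<open>the_elt\<close> in \<open>common_vertex\<close> is meaningful only on a
  singleton. Here the intersection of \<open>P\<close> is one, so each \<open>P\<close> selects a
  genuine row of \<open>H\<close> in which every member of \<open>P\<close> has a nonzero
  entry.\<close>

lemma common_vertex_line_graph:
  assumes "simple_graph \<Gamma>" "P \<in> edges (line_graph \<Gamma>)"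
  shows "common_vertex P \<in> verts \<Gamma>" and "e \<in> P \<Longrightarrow> common_vertex P \<in> e"
proof -
  from assms(2) obtain a b where ab: "P = {a, b}" "a \<in> edges \<Gamma>" "b \<in> edges \<Gamma>"
      "a \<noteq> b" "a \<inter> b \<noteq> {}"
    by (auto simp: line_graph_def)
  then obtain v where v: "a \<inter> b = {v}"
    using simple_graph_inter_edges assms(1) by metis
  then have "common_vertex P = v"
    by (simp add: common_vertex_def ab)
  moreover have "v \<in> a" "v \<in> b" using v by auto
  moreover have "a \<subseteq> verts \<Gamma>" using assms(1) ab by (auto simp: simple_graph_def)
  ultimately show "common_vertex P \<in> verts \<Gamma>" "e \<in> P \<Longrightarrow> common_vertex P \<in> e"
    using ab by auto
qed

lemma line_graph_edge_nth:
  assumes "enumerates Es (edges (line_graph \<Gamma>))" "k < length Es"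
  shows "Es ! k \<in> edges (line_graph \<Gamma>)"
  using assms by (metis enumerates_def nth_mem)

text \<open>The common vertex lies in the edge \<open>es ! i\<close>, so this entry of
  \<open>H\<close> is a group element. This licenses computing with \<open>the_elt\<close> inside
  \<open>line_phase\<close>.\<close>

lemma phases_entry_common_vertex:
  assumes "simple_graph \<Gamma>" "enumerates vs (verts \<Gamma>)"
    and "P \<in> edges (line_graph \<Gamma>)" "i < length es" "es ! i \<in> P" "H \<in> phases vs es"
  shows "H $$ (pos vs (common_vertex P), i) = elt (the_elt (H $$ (pos vs (common_vertex P), i)))"
proof (rule phases_entry)
  have "common_vertex P \<in> set vs" "distinct vs"
    using assms(2) common_vertex_line_graph(1)[OF assms(1,3)] by (auto simp: enumerates_def)
  then show "pos vs (common_vertex P) < length vs" "vs ! pos vs (common_vertex P) \<in> es ! i"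
    using common_vertex_line_graph(2)[OF assms(1,3,5)] by (auto simp: pos_less_length nth_pos)
qed (use assms in auto)

lemma pos_common_vertex_less:
  assumes "simple_graph \<Gamma>" "enumerates vs (verts \<Gamma>)" "P \<in> edges (line_graph \<Gamma>)"
  shows "pos vs (common_vertex P) < length vs"
  using assms common_vertex_line_graph(1) by (metis enumerates_def pos_less_length)

lemma line_phase_carrier: "line_phase vs es Es H \<in> carrier_mat (length es) (length Es)"
  by (simp add: line_phase_def)

text \<open>Inversion reverses products: a factor to the right of an entry of \<open>H\<close>
  becomes its inverse on the left in \<open>L(H)\<close>. The edge that indexes a column of
  \<open>H\<close> indexes a row of \<open>L(H)\<close>, hence the starred diagonal matrix on the
  left.\<close>

lemma line_phase_mult_group_diag:
  assumes "simple_graph \<Gamma>" "enumerates vs (verts \<Gamma>)"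
    and Es: "enumerates Es (edges (line_graph \<Gamma>))"
    and "H \<in> phases vs es" and "g \<in> carrier_vec (length es)"
  shows "line_phase vs es Es (H * group_diag g)
    = mat_star (group_diag g) * line_phase vs es Es H"
proof -
  have H: "H \<in> carrier_mat (length vs) (length es)"
    using assms by (simp add: phases_def)
  show ?thesis
    unfolding mult_group_diag[OF H assms(5)]
      mat_star_group_diag_mult[OF line_phase_carrier assms(5)]
  proof (rule eq_matI, goal_cases)
    case (1 i k)
    then have i: "i < length es" and k: "k < length Es" by auto
    let ?l = "pos vs (common_vertex (Es ! k))"
    note P = line_graph_edge_nth[OF Es k]
    \<comment> \<open>With this bound, entry \<open>(?l, i)\<close> of the scaled matrix, given by
      \<open>mat\<close>, can be evaluated.\<close>
    have l: "?l < length vs" using pos_common_vertex_less assms(1,2) P .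
    show ?case
    proof (cases "es ! i \<in> Es ! k")
      case True
      \<comment> \<open>With \<open>h\<close> in place, both sides become
        \<open>elt (- g $ i + - h)\<close>.\<close>
      obtain h where "H $$ (?l, i) = elt h"
        using phases_entry_common_vertex[OF assms(1,2) P i True assms(4)] by metis
      then show ?thesis using i k l True
        by (simp add: line_phase_def elt_mult minus_add)
    qed (use i k in \<open>simp add: line_phase_def\<close>)
  qed (simp_all add: line_phase_def)
qed

text \<open>The inverse of \<open>- f $ l + h\<close> is \<open>- h + f $ l\<close>, so the scalar
  moves to the right. Its index \<open>l\<close> is the position of the common vertex of
  \<open>Es ! k\<close> and depends on \<open>k\<close> alone, so it scales a whole column; this
  dictates the diagonal.\<close>

lemma line_phase_mat_star_group_diag_mult:
  assumes "simple_graph \<Gamma>" "enumerates vs (verts \<Gamma>)"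
    and Es: "enumerates Es (edges (line_graph \<Gamma>))"
    and "H \<in> phases vs es" and "f \<in> carrier_vec (length vs)"
  shows "line_phase vs es Es (mat_star (group_diag f) * H)
    = line_phase vs es Es H
        * group_diag (vec (length Es) (\<lambda>k. f $ pos vs (common_vertex (Es ! k))))"
proof -
  have H: "H \<in> carrier_mat (length vs) (length es)"
    using assms by (simp add: phases_def)
  show ?thesis
    unfolding mat_star_group_diag_mult[OF H assms(5)]
      mult_group_diag[OF line_phase_carrier vec_carrier]
  proof (rule eq_matI, goal_cases)
    case (1 i k)
    then have i: "i < length es" and k: "k < length Es" by auto
    let ?l = "pos vs (common_vertex (Es ! k))"
    note P = line_graph_edge_nth[OF Es k]
    have l: "?l < length vs" using pos_common_vertex_less assms(1,2) P .
    show ?case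
    proof (cases "es ! i \<in> Es ! k")
      case True
      obtain h where "H $$ (?l, i) = elt h"
        using phases_entry_common_vertex[OF assms(1,2) P i True assms(4)] by metis
      then show ?thesis using i k l True
        by (simp add: line_phase_def elt_mult minus_add)
    qed (use i k in \<open>simp add: line_phase_def\<close>)
  qed (simp_all add: line_phase_def)
qed

text \<open>Let h and h' be the \<open>the_elt\<close> values of \<open>H\<close> in the row of the
  common vertex, at \<open>e\<close> and \<open>e'\<close>. The entries of \<open>L(H)\<close> are
  their inverses, and the second inversion in \<open>Psi\<close> restores h'. Multiplicatively, both
  gains are h^-1 h' up to the central signs.\<close>

lemma Psi_L_eq_Psi_line_phase:
  fixes s\<^sub>1 s\<^sub>2 :: "'g::group_add"
  assumes es: "enumerates es (edges \<Gamma>)"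
    and Es: "enumerates Es (edges (line_graph \<Gamma>))"
    and "s\<^sub>2 \<in> group_center" "s\<^sub>1 + s\<^sub>1 = 0" and adj: "adjacent (line_graph \<Gamma>) e e'"
  shows "Psi_L s\<^sub>2 vs es H e e' = s\<^sub>1 + s\<^sub>2 + Psi s\<^sub>1 es Es (line_phase vs es Es H) e e'"
proof -
  let ?P = "{e, e'}"
  have P: "?P \<in> set Es" "distinct Es"
    using adj Es by (auto simp: adjacent_def enumerates_def)
  have "e \<in> set es" "e' \<in> set es" "distinct es"
    using adj es by (auto simp: adjacent_def line_graph_def enumerates_def doubleton_eq_iff)
  then have entry: "line_phase vs es Es H $$ (pos es x, pos Es ?P)
      = elt (- the_elt (H $$ (pos vs (common_vertex ?P), pos es x)))" if "x \<in> ?P" for x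
    using that P by (auto simp: line_phase_def pos_less_length nth_pos)
  \<comment> \<open>The sign contributed by \<open>Psi\<close> cancels the prefactor
    \<open>s\<^sub>1\<close>: commute \<open>s\<^sub>2\<close> to the front and use that
    \<open>s\<^sub>1\<close> is an involution.\<close>
  have "s\<^sub>1 + s\<^sub>2 + (s\<^sub>1 + x) = s\<^sub>2 + x" for x
  proof -
    have "s\<^sub>1 + s\<^sub>2 = s\<^sub>2 + s\<^sub>1"
      using assms(3) by (simp add: group_center_def)
    then have "s\<^sub>1 + s\<^sub>2 + (s\<^sub>1 + x) = s\<^sub>2 + (s\<^sub>1 + s\<^sub>1) + x"
      by (simp only: add.assoc)
    then show ?thesis using assms(4) by simp
  qed
  then show ?thesis
    by (simp add: Psi_def Psi_L_def Let_def entry add.assoc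
        diff_conv_add_uminus del: add_uminus_conv_diff)
qed

theorem theorem4p32:
  fixes \<Gamma> :: "'v ugraph"
    and vs :: "'v list" and es :: "'v set list" and Es :: "'v set set list"
    and n m q :: nat
    and s\<^sub>1 s\<^sub>2 :: "'g::group_add"
    and H :: "'g group_algebra mat"
    and g f :: "'g vec"
  assumes "finite (verts \<Gamma>)" and "simple_graph \<Gamma>" and "connected_graph \<Gamma>"
    and "edges \<Gamma> \<noteq> {}"
    and "enumerates vs (verts \<Gamma>)" and "enumerates es (edges \<Gamma>)"
    and "enumerates Es (edges (line_graph \<Gamma>))"
    and "n = card (verts \<Gamma>)" and "m = card (edges \<Gamma>)"
    and "q = card (edges (line_graph \<Gamma>))"
    and "s\<^sub>1 \<in> group_center" and "s\<^sub>2 \<in> group_center"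
    and "s\<^sub>1 + s\<^sub>1 = 0" and "s\<^sub>2 + s\<^sub>2 = 0"
    and "H \<in> phases vs es" and "g \<in> carrier_vec m" and "f \<in> carrier_vec n"
  shows "line_phase vs es Es (H * group_diag g)
           = mat_star (group_diag g) * line_phase vs es Es H \<and>
         (\<exists>f' \<in> carrier_vec q.
            line_phase vs es Es (mat_star (group_diag f) * H)
              = line_phase vs es Es H * group_diag f') \<and>
         (\<forall>e e'. adjacent (line_graph \<Gamma>) e e' \<longrightarrow>
            Psi_L s\<^sub>2 vs es H e e'
              = s\<^sub>1 + s\<^sub>2 + Psi s\<^sub>1 es Es (line_phase vs es Es H) e e')"
proof -
  \<comment> \<open>Vector dimensions are stated by cardinalities and phases are sized by list
    lengths; enumerations without repetition identify the two.\<close>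
  have lens: "length vs = n" "length es = m" "length Es = q"
    using assms enumerates_length by metis+
  have "\<exists>f'\<in>carrier_vec q. line_phase vs es Es (mat_star (group_diag f) * H)
      = line_phase vs es Es H * group_diag f'"
  proof (rule bexI)
    show "line_phase vs es Es (mat_star (group_diag f) * H) = line_phase vs es Es H
        * group_diag (vec (length Es) (\<lambda>k. f $ pos vs (common_vertex (Es ! k))))"
      using assms lens by (intro line_phase_mat_star_group_diag_mult) auto
  qed (simp add: lens)
  moreover have "line_phase vs es Es (H * group_diag g)
      = mat_star (group_diag g) * line_phase vs es Es H"
    using assms lens by (intro line_phase_mult_group_diag) auto
  moreover have "Psi_L s\<^sub>2 vs es H e e'
      = s\<^sub>1 + s\<^sub>2 + Psi s\<^sub>1 es Es (line_phase vs es Es H) e e'"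
    if "adjacent (line_graph \<Gamma>) e e'" for e e'
    using assms that by (intro Psi_L_eq_Psi_line_phase) auto
  ultimately show ?thesis
    by blast
qed

end
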